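(* Let $a,b,c,d\in\mathbb{C}$ be four pairwise distinct points and let $p_{ab}=f(d,a,b,c)$, $p_{bc}=f(a,b,c,d)$, $p_{cd}=f(b,c,d,a)$, $p_{da}=f(c,d,a,b)$. (i) If $a,b,c,d$ lie on a circle such that $\mathrm{cr}(c,a,b,d)>0$ (which is the case for a convex quadrilateral, i.e., non-crossing edges), then the four points $p_{ab},p_{bc},p_{cd},p_{da}$ lie on the same circle. (ii) The circle $k(a,b,c,d)$ through $p_{ab},p_{bc},p_{cd},p_{da}$ is connected to $a,b,c,d$ in a Möbius invariant way: for every Möbius transformation $M$ of $\mathbb{C}\cup\{\infty\}$ mapping $a,b,c,d$ to points of $\mathbb{C}$, one has $M(k(a,b,c,d))=k(M(a),M(b),M(c),M(d))$.
   Context: The cross-ratio is $\mathrm{cr}(a,b,c,d)=\frac{(a-b)(c-d)}{(b-c)(d-a)}$. For pairwise distinct $a,b,c,d\in\mathbb{C}$, $$f(a,b,c,d)=\frac{c(b-a)\sqrt{\mathrm{cr}(c,a,b,d)}+b(c-a)}{(b-a)\sqrt{\mathrm{cr}(c,a,b,d)}+(c-a)}\in\mathbb{C}\cup\{\infty\},$$ where $\sqrt{\cdot}$ is the principal square root and the value is $\infty$ if the denominator vanishes. The four points $p_{ab},p_{bc},p_{cd},p_{da}$ are concyclic with $\mathrm{cr}(p_{ab},p_{bc},p_{cd},p_{da})=-1$; a circle containing $\infty$ is a straight line. The edges of the quadrilateral $a,b,c,d$ are $ab$, $bc$, $cd$, $da$. A Möbius transformation is a concatenation of a finite number of reflections in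 spheres (here, in the plane, circles), the reflection in the sphere with center $c_0$ and radius $r$ being $x\mapsto r^2(x-c_0)/\|x-c_0\|^2+c_0$, $\infty\mapsto c_0$, $c_0\mapsto\infty$.
   Formalization: In (i), cr(c,a,b,d)>0 alone gives only p_bc, p_da on the circle; for all four, cr(d,b,c,a)>0 is also assumed (a=0,b=2,c=1,d=3 is a counterexample otherwise). Non-crossing edges are proved to imply both conditions. *)

theory Defs
  imports "HOL-Analysis.Analysis"
begin

text \<open>The extended plane is modelled by the type \<open>complex option\<close>, with \<open>None\<close> as the point at
  infinity.\<close>

definition cross_ratio :: "complex \<Rightarrow> complex \<Rightarrow> complex \<Rightarrow> complex \<Rightarrow> complex" where
  "cross_ratio a b c d = ((a - b) * (c - d)) / ((b - c) * (d - a))"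

definition edge_point :: "complex \<Rightarrow> complex \<Rightarrow> complex \<Rightarrow> complex \<Rightarrow> complex option" where
  "edge_point a b c d =
    (let s = csqrt (cross_ratio c a b d);
         den = (b - a) * s + (c - a)
     in if den = 0 then None else Some ((c * (b - a) * s + b * (c - a)) / den))"

definition gen_circle :: "complex option set \<Rightarrow> bool" where
  "gen_circle K \<longleftrightarrow>
     (\<exists>z r. r > 0 \<and> K = Some ` sphere z r) \<or>
     (\<exists>u v. u \<noteq> v \<and> K = insert None (Some ` (affine hull {u, v})))"

definition quad_circle :: "complex \<Rightarrow> complex \<Rightarrow> complex \<Rightarrow> complex \<Rightarrow> complex option set" where
  "quad_circle a b c d =
     (THE K. gen_circle K \<and>
        {edge_point d a b c, edge_point a b c d, edge_point b c d a, edge_point c d a b} \<subseteq> K)"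

fun circle_reflection :: "complex \<Rightarrow> real \<Rightarrow> complex option \<Rightarrow> complex option" where
  "circle_reflection c r None = Some c"
| "circle_reflection c r (Some z) =
     (if z = c then None else Some ((r\<^sup>2 / (norm (z - c))\<^sup>2) *\<^sub>R (z - c) + c))"

text \<open>Reflections in straight lines need no separate rule: each of them is
  a composition of three reflections in circles of positive radius.\<close>

inductive moebius :: "(complex option \<Rightarrow> complex option) \<Rightarrow> bool" where
  moebius_id: "moebius id"
| moebius_step: "r > 0 \<Longrightarrow> moebius M \<Longrightarrow> moebius (circle_reflection c r \<circ> M)"

text \<open>Only the two pairs of opposite edges are compared, since adjacent edges always share
  a vertex.\<close>

definition noncrossing_edges :: "complex \<Rightarrow> complex \<Rightarrow> complex \<Rightarrow> complex \<Rightarrow> bool" where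
  "noncrossing_edges a b c d \<longleftrightarrow>
     closed_segment a b \<inter> closed_segment c d = {} \<and>
     closed_segment b c \<inter> closed_segment d a = {}"

definition positive_real :: "complex \<Rightarrow> bool" where
  "positive_real z \<longleftrightarrow> z \<in> \<real> \<and> Re z > 0"

text \<open>The four values \<open>edge_point d a b c\<close>, \<open>edge_point a b c d\<close>, \<open>edge_point b c d a\<close>,
  \<open>edge_point c d a b\<close> involve two different radicands, by the following identity and its cyclic shift.\<close>

lemma cross_ratio_opposite: "cross_ratio c a b d = cross_ratio a c d b"
  unfolding cross_ratio_def by (simp add: algebra_simps)

text \<open>Positivity of one radicand does not imply positivity of the other, and it does not place
  all four points on the circle through \<open>a, b, c, d\<close>: take \<open>a = 0\<close>, \<open>b = 2\<close>, \<open>c = 1\<close>, \<open>d = 3\<close> on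
  the real axis, where the edges \<open>ab\<close> and \<open>cd\<close> cross.\<close>

lemma one_positive_radicand_insufficient:
  "positive_real (cross_ratio 1 0 2 3)"
  "\<not> positive_real (cross_ratio 3 2 1 0)"
  "edge_point 2 1 3 0 \<notin> insert None (Some ` \<real>)"
proof -
  show "positive_real (cross_ratio 1 0 2 3)" "\<not> positive_real (cross_ratio 3 2 1 0)"
    by (simp_all add: positive_real_def cross_ratio_def)
  define s where "s = csqrt (cross_ratio 3 2 1 0)"
  have cr: "cross_ratio 3 2 1 0 = of_real (- 1 / 3)"
    by (simp add: cross_ratio_def)
  have s: "s = \<i> * of_real (sqrt (1 / 3))"
    unfolding s_def cr by (subst csqrt_of_real_nonpos) auto
  have Re: "Re s = 0" and Im: "Im s \<noteq> 0"
    by (simp_all add: s)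
  have den: "1 - s \<noteq> 0"
    using Re by (auto simp: complex_eq_iff)
  have e: "edge_point 2 1 3 0 = Some ((1 - 3 * s) / (1 - s))"
    using den by (simp add: edge_point_def Let_def flip: s_def)
  have "(1 - 3 * s) / (1 - s) \<noteq> of_real t" for t
  proof
    assume "(1 - 3 * s) / (1 - s) = of_real t"
    then have "1 - 3 * s = of_real t * (1 - s)"
      using den by (simp add: field_simps)
    then have "Re (1 - 3 * s) = Re (of_real t * (1 - s))" "Im (1 - 3 * s) = Im (of_real t * (1 - s))"
      by simp_all
    then show False
      using Re Im by simp
  qed
  then show "edge_point 2 1 3 0 \<notin> insert None (Some ` \<real>)"
    by (auto simp: e Reals_def)
qed

end

theory Submission
  imports Defs
begin

text \<open>
  Three distinct points \<open>a\<close>, \<open>b\<close>, \<open>c\<close> define a projective coordinate on the extended plane, here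
  the parametrisation \<open>frame a b c\<close>, in which \<open>c\<close>, \<open>b\<close>, \<open>a\<close> become \<open>\<infinity>\<close>, \<open>0\<close>, \<open>- 1\<close>. The point
  \<open>edge_point a b c d\<close> has as coordinate the principal square root \<open>s\<close> of the cross-ratio, and the
  coordinate of \<open>d\<close> is \<open>- s\<^sup>2\<close>.

  The opposite edge point has the coordinate \<open>- s\<close> (\<open>frame_opposite\<close>), and the two others have
  coordinates whose product is \<open>s\<^sup>2\<close> (\<open>frame_shift\<close>, \<open>cross_ratio_shift\<close>). Hence the two pairs are
  harmonic. Four harmonic points form the image of \<open>\<infinity>, 0, 1, - 1\<close> under a fractional linear map, and
  the unique circle through them is the image of the real line (\<open>harmonic_points_on_circle\<close>).

  By \<open>frame_opposite\<close> the set of edge points can be described using both square roots of each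
  cross-ratio (\<open>edge_points_eq_quad_points\<close>). A Moebius map is fractional linear or such a map after
  conjugation (\<open>moebius_cases\<close>). In the second case the principal root of a negative cross-ratio is
  not mapped to a principal root, so opposite edge points are exchanged; but the set of all roots, and
  hence the set of edge points, is preserved in both cases (\<open>quad_points_moebius\<close>). As Moebius
  maps preserve circles, the circle through the edge points is preserved as well.

  If \<open>a\<close>, \<open>b\<close>, \<open>c\<close>, \<open>d\<close> lie on a circle \<open>K\<close>, then \<open>K\<close> is the image of the real line in the coordinate
  above (\<open>circle_eq_frame_image\<close>). So the cross-ratio is real, and if it is positive, the roots
  \<open>s\<close> and \<open>- s\<close> are real and the edge points lie on \<open>K\<close>. A negative cross-ratio would mean that
  \<open>b\<close> and \<open>c\<close> are separated on \<open>K\<close> by \<open>a\<close> and \<open>d\<close>, so that the edges \<open>bc\<close> and \<open>da\<close> meet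
  (\<open>edges_cross_if_cross_ratio_negative\<close>).
\<close>

section \<open>Fractional linear maps on the extended plane\<close>

text \<open>The point with homogeneous coordinates \<open>x : y\<close>. The pair \<open>(0, 0)\<close> is no point of the
  projective line; it gets the junk value \<open>None\<close>, so lemmas assume \<open>x \<noteq> 0 \<or> y \<noteq> 0\<close> where this matters.\<close>
definition proj :: "complex \<Rightarrow> complex \<Rightarrow> complex option" where
  "proj x y = (if y = 0 then None else Some (x / y))"

definition linfrac ::
  "complex \<Rightarrow> complex \<Rightarrow> complex \<Rightarrow> complex \<Rightarrow> complex option \<Rightarrow> complex option" where
  "linfrac p q r s z =
     (case z of None \<Rightarrow> proj p r | Some w \<Rightarrow> proj (p * w + q) (r * w + s))"

lemma proj_scale: "k \<noteq> 0 \<Longrightarrow> proj (k * x) (k * y) = proj x y"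
  by (simp add: proj_def)

text \<open>Equations between points become polynomial identities by cross-multiplication, with no case
  distinction for the point at infinity.\<close>
lemma proj_eqI:
  assumes "x * y' = x' * y" "x \<noteq> 0 \<or> y \<noteq> 0" "x' \<noteq> 0 \<or> y' \<noteq> 0"
  shows "proj x y = proj x' y'"
  using assms by (auto simp: proj_def field_simps)

text \<open>On homogeneous coordinates a fractional linear map is multiplication by the matrix with rows
  \<open>(p, q)\<close> and \<open>(r, s)\<close>; composition and inversion below are therefore matrix multiplication and the
  adjugate matrix.\<close>
lemma linfrac_proj:
  assumes "x \<noteq> 0 \<or> y \<noteq> 0"
  shows "linfrac p q r s (proj x y) = proj (p * x + q * y) (r * x + s * y)"
proof (cases "y = 0")
  case True
  with assms show ?thesis
    using proj_scale[of x p r] by (simp add: linfrac_def proj_def mult.commute)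
next
  case False
  then have "proj (p * x + q * y) (r * x + s * y) = proj (y * (p * (x / y) + q)) (y * (r * (x / y) + s))"
    by (simp add: algebra_simps)
  with False show ?thesis
    by (simp add: proj_scale linfrac_def) (simp add: proj_def)
qed

lemma proj_surj: obtains x y where "z = proj x y" "x \<noteq> 0 \<or> y \<noteq> 0"
proof (cases z)
  case None
  then show ?thesis using that[of 1 0] by (simp add: proj_def)
next
  case (Some w)
  then show ?thesis using that[of w 1] by (simp add: proj_def)
qed

lemma det_nonzero_imp:
  fixes p q r s x y :: complex
  assumes "p * s \<noteq> q * r" "x \<noteq> 0 \<or> y \<noteq> 0"
  shows "p * x + q * y \<noteq> 0 \<or> r * x + s * y \<noteq> 0"
proof (rule ccontr)
  assume "\<not> ?thesis"
  then have e: "p * x + q * y = 0" "r * x + s * y = 0" by auto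
  have "(p * s - q * r) * x = s * (p * x + q * y) - q * (r * x + s * y)"
    "(p * s - q * r) * y = p * (r * x + s * y) - r * (p * x + q * y)"
    by (simp_all add: algebra_simps)
  with e assms show False by auto
qed

lemma linfrac_compose:
  assumes "p' * s' \<noteq> q' * r'"
  shows "linfrac p q r s (linfrac p' q' r' s' z) =
    linfrac (p * p' + q * r') (p * q' + q * s') (r * p' + s * r') (r * q' + s * s') z"
proof -
  obtain x y where z: "z = proj x y" "x \<noteq> 0 \<or> y \<noteq> 0" by (rule proj_surj)
  show ?thesis
    using det_nonzero_imp[OF assms z(2)] z(2) unfolding z(1)
    by (simp add: linfrac_proj) (simp add: algebra_simps)
qed

lemma linfrac_scalar: "k \<noteq> 0 \<Longrightarrow> linfrac k 0 0 k z = z"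
  by (cases z) (auto simp: linfrac_def proj_def)

lemma linfrac_inverse:
  assumes "p * s \<noteq> q * r"
  shows "linfrac s (- q) (- r) p (linfrac p q r s z) = z"
  using linfrac_scalar[of "p * s - q * r" z] assms
  by (simp add: linfrac_compose algebra_simps)

lemma map_cnj_linfrac:
  "map_option cnj (linfrac p q r s z) =
   linfrac (cnj p) (cnj q) (cnj r) (cnj s) (map_option cnj z)"
proof -
  have "cnj u = 0 \<longleftrightarrow> u = 0" for u by simp
  then show ?thesis
    by (cases z) (auto simp: linfrac_def proj_def simp flip: complex_cnj_mult complex_cnj_add)
qed

text \<open>Since \<open>\<bar>z - c\<bar>\<^sup>2 = (z - c) * cnj (z - c)\<close>, the reflection sends \<open>z\<close> to
  \<open>c + r\<^sup>2 / cnj (z - c)\<close>; this is conjugation followed by a fractional linear map of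
  determinant \<open>- r\<^sup>2\<close>.\<close>
lemma circle_reflection_eq_linfrac:
  assumes "r > 0"
  shows "circle_reflection c r z =
    linfrac c (of_real (r\<^sup>2) - c * cnj c) 1 (- cnj c) (map_option cnj z)"
proof (cases z)
  case None
  then show ?thesis by (simp add: linfrac_def proj_def)
next
  case (Some w)
  have "(of_real (r\<^sup>2 / (cmod (w - c))\<^sup>2)) * (w - c) = of_real (r\<^sup>2) / cnj (w - c)" if "w \<noteq> c"
    using that unfolding of_real_divide complex_norm_square by (simp add: divide_simps)
  moreover have "cnj w - cnj c \<noteq> 0" if "w \<noteq> c"
    using that by (simp flip: complex_cnj_diff)
  ultimately show ?thesis
    using Some by (auto simp: linfrac_def proj_def scaleR_conv_of_real field_simps)
qed

text \<open>Conjugation can be moved past a fractional linear map by conjugating the coefficients, and two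
  conjugations cancel. So a product of reflections involves at most one conjugation.\<close>
lemma moebius_cases:
  assumes "moebius M"
  obtains p q r s where "p * s \<noteq> q * r"
    "M = linfrac p q r s \<or> M = linfrac p q r s \<circ> map_option cnj"
proof -
  from assms have "\<exists>p q r s. p * s \<noteq> q * r \<and>
    (M = linfrac p q r s \<or> M = linfrac p q r s \<circ> map_option cnj)"
  proof induction
    case moebius_id
    show ?case
      by (rule exI[of _ 1], rule exI[of _ 0], rule exI[of _ 0], rule exI[of _ 1])
        (simp add: fun_eq_iff linfrac_scalar)
  next
    case (moebius_step \<rho> M c)
    from moebius_step.IH obtain p q r s where det: "p * s \<noteq> q * r"
      and M: "M = linfrac p q r s \<or> M = linfrac p q r s \<circ> map_option cnj" by blast
    define e where "e = of_real (\<rho>\<^sup>2) - c * cnj c"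
    define p' where "p' = c * cnj p + e * cnj r"
    define q' where "q' = c * cnj q + e * cnj s"
    define r' where "r' = cnj p - cnj c * cnj r"
    define s' where "s' = cnj q - cnj c * cnj s"
    have det': "cnj p * cnj s \<noteq> cnj q * cnj r"
      using det by (metis complex_cnj_cancel_iff complex_cnj_mult)
    have refl: "circle_reflection c \<rho> (linfrac p q r s z) = linfrac p' q' r' s' (map_option cnj z)" for z
      using linfrac_compose[OF det', of c e 1 "- cnj c" "map_option cnj z"] moebius_step.hyps(1)
      by (simp add: circle_reflection_eq_linfrac map_cnj_linfrac p'_def q'_def r'_def s'_def e_def)
    have "p' * s' - q' * r' = - of_real (\<rho>\<^sup>2) * (cnj p * cnj s - cnj q * cnj r)"
      unfolding p'_def q'_def r'_def s'_def e_def by (simp add: algebra_simps)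
    then have "p' * s' \<noteq> q' * r'"
      using det' moebius_step.hyps(1) by auto
    moreover have "map_option cnj (map_option cnj z) = z" for z
      by (cases z) auto
    ultimately show ?case
      using M refl by (intro exI[of _ p'] exI[of _ q'] exI[of _ r'] exI[of _ s']) (auto simp: fun_eq_iff)
  qed
  then show ?thesis using that by blast
qed

section \<open>Circles as zero sets of Hermitian forms\<close>

text \<open>The Hermitian form with matrix entries \<open>A\<close>, \<open>B\<close>, \<open>cnj B\<close>, \<open>C\<close>. Circles and straight lines
  are the zero sets on the projective line of the indefinite forms, that is, of those with
  \<open>A * C < \<bar>B\<bar>\<^sup>2\<close>; lines are the case \<open>A = 0\<close>.\<close>
definition hform :: "real \<Rightarrow> complex \<Rightarrow> real \<Rightarrow> complex \<Rightarrow> complex \<Rightarrow> real" where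
  "hform A B C x y = A * (cmod x)\<^sup>2 + 2 * Re (cnj B * x * cnj y) + C * (cmod y)\<^sup>2"

definition hcircle :: "real \<Rightarrow> complex \<Rightarrow> real \<Rightarrow> complex option set" where
  "hcircle A B C = {z. hform A B C (case z of None \<Rightarrow> 1 | Some w \<Rightarrow> w) (case z of None \<Rightarrow> 0 | Some w \<Rightarrow> 1) = 0}"

lemma None_in_hcircle: "None \<in> hcircle A B C \<longleftrightarrow> A = 0"
  by (simp add: hcircle_def hform_def)

lemma Some_in_hcircle: "Some z \<in> hcircle A B C \<longleftrightarrow> A * (cmod z)\<^sup>2 + 2 * Re (cnj B * z) + C = 0"
  by (simp add: hcircle_def hform_def)

lemma hform_scale: "hform A B C (k * x) (k * y) = (cmod k)\<^sup>2 * hform A B C x y"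
  by (simp add: hform_def norm_mult cmod_power2 power_mult_distrib) (simp add: power2_eq_square algebra_simps)

lemma proj_in_hcircle:
  assumes "x \<noteq> 0 \<or> y \<noteq> 0"
  shows "proj x y \<in> hcircle A B C \<longleftrightarrow> hform A B C x y = 0"
proof (cases "y = 0")
  case True
  with assms show ?thesis by (simp add: proj_def None_in_hcircle hform_def)
next
  case False
  then show ?thesis
    using hform_scale[of A B C y "x / y" 1] by (simp add: proj_def hcircle_def)
qed

lemma of_real_hform:
  "of_real (hform A B C x y) =
    of_real A * (x * cnj x) + (cnj B * x * cnj y + B * cnj x * y) + of_real C * (y * cnj y)"
  unfolding hform_def cmod_power2
  by (simp add: complex_eq_iff power2_eq_square algebra_simps)

text \<open>A linear substitution turns the matrix \<open>H\<close> of the form into \<open>P\<^sup>* H P\<close>, whose entries are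
  written out here. The next lemma is the product rule for its determinant.\<close>
lemma hform_substitution:
  "hform A B C (p * x + q * y) (r * x + s * y) =
   hform (hform A B C p r)
     (A * cnj p * q + B * cnj p * s + cnj B * q * cnj r + C * cnj r * s)
     (hform A B C q s) x y"
proof -
  have "complex_of_real (hform A B C (p * x + q * y) (r * x + s * y)) =
   of_real (hform (hform A B C p r)
     (A * cnj p * q + B * cnj p * s + cnj B * q * cnj r + C * cnj r * s)
     (hform A B C q s) x y)"
    \<comment> \<open>In terms of \<open>x\<close> and \<open>cnj x\<close> as independent variables this is a ring identity.\<close>
    unfolding of_real_hform by (simp add: algebra_simps)
  then show ?thesis by (simp only: of_real_eq_iff)
qed

lemma hform_discriminant:
  assumes "p * s \<noteq> q * r" and "A * C < (cmod B)\<^sup>2"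
  shows "hform A B C p r * hform A B C q s <
    (cmod (A * cnj p * q + B * cnj p * s + cnj B * q * cnj r + C * cnj r * s))\<^sup>2"
proof -
  have "complex_of_real ((cmod (A * cnj p * q + B * cnj p * s + cnj B * q * cnj r + C * cnj r * s))\<^sup>2
      - hform A B C p r * hform A B C q s) =
    of_real ((cmod (p * s - q * r))\<^sup>2 * ((cmod B)\<^sup>2 - A * C))"
    unfolding of_real_diff of_real_mult of_real_hform complex_norm_square
    by (simp add: algebra_simps)
  then have "(cmod (A * cnj p * q + B * cnj p * s + cnj B * q * cnj r + C * cnj r * s))\<^sup>2
      - hform A B C p r * hform A B C q s = (cmod (p * s - q * r))\<^sup>2 * ((cmod B)\<^sup>2 - A * C)"
    by (simp only: of_real_eq_iff)
  moreover have "\<dots> > 0" using assms by simp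
  ultimately show ?thesis by linarith
qed

lemma option_set_eqI:
  assumes "None \<in> S \<longleftrightarrow> None \<in> T" "\<And>w. Some w \<in> S \<longleftrightarrow> Some w \<in> T"
  shows "S = T"
  using assms by (metis not_Some_eq subsetI subset_antisym)

lemma sphere_eq_hcircle:
  assumes "r > 0"
  shows "Some ` sphere z r = hcircle 1 (- z) ((cmod z)\<^sup>2 - r\<^sup>2)"
proof (rule option_set_eqI)
  show "None \<in> Some ` sphere z r \<longleftrightarrow> None \<in> hcircle 1 (- z) ((cmod z)\<^sup>2 - r\<^sup>2)"
    by (simp add: None_in_hcircle image_iff)
  fix w
  have "Some w \<in> Some ` sphere z r \<longleftrightarrow> cmod (w - z) = r"
    by (auto simp: dist_norm norm_minus_commute)
  also have "\<dots> \<longleftrightarrow> (cmod (w - z))\<^sup>2 = r\<^sup>2"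
    using assms by (metis less_le norm_ge_zero power2_eq_iff_nonneg)
  also have "(cmod (w - z))\<^sup>2 = (cmod w)\<^sup>2 + 2 * Re (cnj (- z) * w) + (cmod z)\<^sup>2"
    unfolding cmod_power2 by (simp add: power2_eq_square algebra_simps)
  also have "\<dots> = r\<^sup>2 \<longleftrightarrow> Some w \<in> hcircle 1 (- z) ((cmod z)\<^sup>2 - r\<^sup>2)"
    unfolding Some_in_hcircle by linarith
  finally show "Some w \<in> Some ` sphere z r \<longleftrightarrow> Some w \<in> hcircle 1 (- z) ((cmod z)\<^sup>2 - r\<^sup>2)" .
qed

lemma in_line_iff:
  fixes u v :: complex
  shows "w \<in> affine hull {u, v} \<longleftrightarrow> (\<exists>t::real. w = u + t * (v - u))"
proof -
  have "w = of_real (1 - y) * u + of_real y * v \<longleftrightarrow> w = u + of_real y * (v - u)" for y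
    by (simp add: algebra_simps)
  moreover have "x + y = 1 \<longleftrightarrow> x = 1 - y" for x y :: real by auto
  ultimately show ?thesis
    by (simp add: affine_hull_2 scaleR_conv_of_real)
qed

lemma line_eq_hcircle:
  assumes "u \<noteq> v"
  shows "insert None (Some ` (affine hull {u, v})) =
     hcircle 0 (\<i> * (v - u)) (- 2 * Re (cnj (\<i> * (v - u)) * u))"
proof (rule option_set_eqI)
  show "None \<in> insert None (Some ` (affine hull {u, v})) \<longleftrightarrow>
      None \<in> hcircle 0 (\<i> * (v - u)) (- 2 * Re (cnj (\<i> * (v - u)) * u))"
    by (simp add: None_in_hcircle)
  fix w
  have "Some w \<in> insert None (Some ` (affine hull {u, v})) \<longleftrightarrow> w \<in> affine hull {u, v}"
    by auto
  also have "\<dots> \<longleftrightarrow> (\<exists>t::real. (w - u) / (v - u) = of_real t)"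
    using assms unfolding in_line_iff by (simp add: field_simps)
  also have "\<dots> \<longleftrightarrow> Im ((w - u) / (v - u)) = 0"
    by (metis Reals_cases complex_is_Real_iff Im_complex_of_real)
  also have "\<dots> \<longleftrightarrow> Im ((w - u) * cnj (v - u)) = 0"
    by (rule Im_complex_div_eq_0)
  also have "Im ((w - u) * cnj (v - u)) = Re (cnj (\<i> * (v - u)) * w) - Re (cnj (\<i> * (v - u)) * u)"
    by (simp add: algebra_simps)
  also have "\<dots> = 0 \<longleftrightarrow>
      Some w \<in> hcircle 0 (\<i> * (v - u)) (- 2 * Re (cnj (\<i> * (v - u)) * u))"
    unfolding Some_in_hcircle by linarith
  finally show "Some w \<in> insert None (Some ` (affine hull {u, v})) \<longleftrightarrow>
      Some w \<in> hcircle 0 (\<i> * (v - u)) (- 2 * Re (cnj (\<i> * (v - u)) * u))" .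
qed

text \<open>For \<open>A \<noteq> 0\<close>, completing the square gives the centre \<open>- B / A\<close> and the squared radius
  \<open>(\<bar>B\<bar>\<^sup>2 - A * C) / A\<^sup>2\<close>. For \<open>A = 0\<close>, the form is affine in the plane and describes a line
  orthogonal to \<open>B\<close>.\<close>
lemma gen_circle_iff_hcircle:
  "gen_circle K \<longleftrightarrow> (\<exists>A B C. A * C < (cmod B)\<^sup>2 \<and> K = hcircle A B C)"
proof
  assume "gen_circle K"
  then consider z r where "r > 0" "K = Some ` sphere z r"
    | u v where "u \<noteq> v" "K = insert None (Some ` (affine hull {u, v}))"
    unfolding gen_circle_def by blast
  then show "\<exists>A B C. A * C < (cmod B)\<^sup>2 \<and> K = hcircle A B C"
  proof cases
    case 1
    then show ?thesis
      by (intro exI[of _ 1] exI[of _ "- z"] exI[of _ "(cmod z)\<^sup>2 - r\<^sup>2"]) (simp add: sphere_eq_hcircle)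
  next
    case 2
    then show ?thesis
      using line_eq_hcircle[of u v]
      by (intro exI[of _ 0] exI[of _ "\<i> * (v - u)"] exI[of _ "- 2 * Re (cnj (\<i> * (v - u)) * u)"])
        (simp add: norm_mult)
  qed
next
  assume "\<exists>A B C. A * C < (cmod B)\<^sup>2 \<and> K = hcircle A B C"
  then obtain A B C where disc: "A * C < (cmod B)\<^sup>2" and K: "K = hcircle A B C" by blast
  show "gen_circle K"
  proof (cases "A = 0")
    case False
    define r where "r = sqrt ((cmod B)\<^sup>2 - A * C) / \<bar>A\<bar>"
    define z where "z = - B / of_real A"
    have r: "r > 0" using disc False by (simp add: r_def)
    have r2: "r\<^sup>2 = ((cmod B)\<^sup>2 - A * C) / A\<^sup>2" using disc by (simp add: r_def power_divide)
    have "K = hcircle 1 (- z) ((cmod z)\<^sup>2 - r\<^sup>2)"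
    proof (rule set_eqI)
      fix w
      have "(cmod z)\<^sup>2 - r\<^sup>2 = C / A"
        unfolding r2 using False by (simp add: z_def norm_divide field_simps power2_eq_square)
      moreover have "Re (cnj (- z) * u) = Re (cnj B * u) / A" for u
        by (simp add: z_def field_simps)
      ultimately have *: "hform 1 (- z) ((cmod z)\<^sup>2 - r\<^sup>2) x y = hform A B C x y / A" for x y
        using False unfolding hform_def mult.assoc by (simp only: add_divide_distrib) simp
      show "w \<in> K \<longleftrightarrow> w \<in> hcircle 1 (- z) ((cmod z)\<^sup>2 - r\<^sup>2)"
        using False by (simp add: K hcircle_def *)
    qed
    then show ?thesis
      using r sphere_eq_hcircle[OF r, of z] unfolding gen_circle_def by metis
  next
    case True
    then have B: "B \<noteq> 0" using disc by auto
    \<comment> \<open>The foot \<open>u\<close> of the perpendicular from the origin lies on the line, and \<open>\<i> * B\<close> is its direction.\<close>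
    define k where "k = - C / (2 * (cmod B)\<^sup>2)"
    define u where "u = of_real k * B"
    define v where "v = u - \<i> * B"
    have "Re (cnj B * u) = k * (cmod B)\<^sup>2"
      unfolding cmod_power2 by (simp add: u_def power2_eq_square algebra_simps)
    then have "- 2 * Re (cnj B * u) = C"
      using B by (simp add: k_def)
    moreover have vu: "\<i> * (v - u) = B"
      by (simp add: v_def)
    ultimately have C: "- 2 * Re (cnj (\<i> * (v - u)) * u) = C"
      by simp
    have "u \<noteq> v" using B by (simp add: v_def)
    moreover from this have "K = insert None (Some ` (affine hull {u, v}))"
      using line_eq_hcircle[of u v] unfolding C unfolding vu K True by simp
    ultimately show ?thesis unfolding gen_circle_def by blast
  qed
qed

section \<open>Bijections of the extended plane that preserve circles\<close>

definition circle_bij :: "(complex option \<Rightarrow> complex option) \<Rightarrow> bool" where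
  "circle_bij N \<longleftrightarrow> bij N \<and> (\<forall>K. gen_circle (N ` K) \<longleftrightarrow> gen_circle K)"

lemma circle_bijI:
  assumes "\<And>z. g (f z) = z" "\<And>z. f (g z) = z"
    and "\<And>K. gen_circle K \<Longrightarrow> gen_circle (f -` K)" "\<And>K. gen_circle K \<Longrightarrow> gen_circle (g -` K)"
  shows "circle_bij f"
proof -
  have "f ` K = g -` K" for K
    using assms(1,2) by (auto simp: image_iff) metis
  moreover have "f -` (g -` K) = K" for K
    using assms(1) by auto
  moreover have "bij f"
    using assms(1,2) by (metis bijI')
  ultimately show ?thesis
    unfolding circle_bij_def using assms(3,4) by metis
qed

lemma circle_bij_compose: "circle_bij f \<Longrightarrow> circle_bij g \<Longrightarrow> circle_bij (f \<circ> g)"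
  unfolding circle_bij_def image_comp[symmetric] by (auto intro: bij_comp)

lemma gen_circle_vimage_linfrac:
  assumes "gen_circle K" "p * s \<noteq> q * r"
  shows "gen_circle (linfrac p q r s -` K)"
proof -
  obtain A B C where disc: "A * C < (cmod B)\<^sup>2" and K: "K = hcircle A B C"
    using assms(1) gen_circle_iff_hcircle by blast
  have "linfrac p q r s z \<in> K \<longleftrightarrow> z \<in> hcircle (hform A B C p r)
     (A * cnj p * q + B * cnj p * s + cnj B * q * cnj r + C * cnj r * s) (hform A B C q s)" for z
  proof -
    obtain x y where z: "z = proj x y" "x \<noteq> 0 \<or> y \<noteq> 0" by (rule proj_surj)
    show ?thesis
      using det_nonzero_imp[OF assms(2) z(2)] z(2) unfolding z(1) K
      by (simp add: linfrac_proj proj_in_hcircle hform_substitution)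
  qed
  then show ?thesis
    using hform_discriminant[OF assms(2) disc] unfolding gen_circle_iff_hcircle by blast
qed

lemma circle_bij_linfrac:
  assumes "p * s \<noteq> q * r"
  shows "circle_bij (linfrac p q r s)"
proof (rule circle_bijI)
  have det: "s * p \<noteq> (- q) * (- r)" using assms by (simp add: mult.commute)
  show "linfrac s (- q) (- r) p (linfrac p q r s z) = z" for z
    by (rule linfrac_inverse[OF assms])
  show "linfrac p q r s (linfrac s (- q) (- r) p z) = z" for z
    using linfrac_inverse[OF det] by simp
  show "gen_circle (linfrac p q r s -` K)" "gen_circle (linfrac s (- q) (- r) p -` K)"
    if "gen_circle K" for K
    using gen_circle_vimage_linfrac[OF that] assms det by blast+
qed

lemma circle_bij_cnj: "circle_bij (map_option cnj)"
proof -
  have inv: "map_option cnj (map_option cnj z) = z" for z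
    by (cases z) auto
  have "gen_circle (map_option cnj -` K)" if "gen_circle K" for K
  proof -
    from that obtain A B C where disc: "A * C < (cmod B)\<^sup>2" and K: "K = hcircle A B C"
      using gen_circle_iff_hcircle by blast
    have "map_option cnj -` K = hcircle A (cnj B) C"
      by (rule option_set_eqI) (simp_all add: K None_in_hcircle Some_in_hcircle)
    with disc show ?thesis unfolding gen_circle_iff_hcircle by (metis complex_mod_cnj)
  qed
  with inv show ?thesis by (intro circle_bijI)
qed

lemma ex1_circle_image:
  assumes N: "circle_bij N" and ex1: "\<exists>!k. gen_circle k \<and> P \<subseteq> k"
  shows "\<exists>!k. gen_circle k \<and> N ` P \<subseteq> k"
proof -
  from ex1 obtain k where k: "gen_circle k" "P \<subseteq> k"
    and uniq: "\<And>k'. gen_circle k' \<Longrightarrow> P \<subseteq> k' \<Longrightarrow> k' = k" by blast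
  show ?thesis
  proof (rule ex1I[of _ "N ` k"])
    show "gen_circle (N ` k) \<and> N ` P \<subseteq> N ` k"
      using N k by (auto simp: circle_bij_def)
    fix k' assume k': "gen_circle k' \<and> N ` P \<subseteq> k'"
    have "N ` (N -` k') = k'"
      using N by (simp add: circle_bij_def bij_is_surj)
    moreover have "P \<subseteq> N -` k'" using k' by auto
    ultimately show "k' = N ` k"
      using uniq[of "N -` k'"] N k' by (metis circle_bij_def)
  qed
qed

definition real_line :: "complex option set" where
  "real_line = insert None (Some ` \<real>)"

lemma gen_circle_real_line: "gen_circle real_line"
proof -
  have "affine hull {0, 1::complex} = \<real>"
    by (auto simp: in_line_iff elim: Reals_cases)
  then show ?thesis
    unfolding real_line_def gen_circle_def by (metis zero_neq_one)
qed

text \<open>The form of \<open>K\<close> has \<open>A = 0\<close> because of the point at infinity, \<open>C = 0\<close> because of the origin,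
  and an imaginary \<open>B\<close> because of the nonzero real point.\<close>
lemma real_line_unique:
  assumes "gen_circle K" "None \<in> K" "Some 0 \<in> K" "Some (of_real t) \<in> K" "t \<noteq> 0"
  shows "K = real_line"
proof -
  obtain A B C where disc: "A * C < (cmod B)\<^sup>2" and K: "K = hcircle A B C"
    using assms(1) gen_circle_iff_hcircle by blast
  have A: "A = 0" and C: "C = 0" and B: "Re B = 0"
    using assms(2-) K by (auto simp: None_in_hcircle Some_in_hcircle)
  then have "Im B \<noteq> 0" using disc by (auto simp: cmod_def)
  have "z \<in> K \<longleftrightarrow> z \<in> real_line" for z
    by (cases z) (use A B C \<open>Im B \<noteq> 0\<close> in
      \<open>auto simp: K None_in_hcircle Some_in_hcircle real_line_def image_iff complex_is_Real_iff\<close>)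
  then show ?thesis by blast
qed

section \<open>Edge points in a projective coordinate\<close>

text \<open>The projective coordinate on the extended plane in which \<open>c\<close>, \<open>b\<close>, \<open>a\<close> are the points
  \<open>\<infinity>\<close>, \<open>0\<close>, \<open>- 1\<close>. The formula defining \<open>edge_point\<close> is this map evaluated at a square root of
  the cross-ratio.\<close>
definition frame :: "complex \<Rightarrow> complex \<Rightarrow> complex \<Rightarrow> complex option \<Rightarrow> complex option" where
  "frame a b c = linfrac (c * (b - a)) (b * (c - a)) (b - a) (c - a)"

lemma frame_Some: "frame a b c (Some w) = proj (c * (b - a) * w + b * (c - a)) ((b - a) * w + (c - a))"
  by (simp add: frame_def linfrac_def)

lemma edge_point_eq_frame:
  "edge_point a b c d = frame a b c (Some (csqrt (cross_ratio c a b d)))"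
  by (simp add: edge_point_def frame_Some proj_def Let_def)

lemma frame_det:
  fixes a b c :: complex
  assumes "distinct [a, b, c]"
  shows "c * (b - a) * (c - a) \<noteq> b * (c - a) * (b - a)"
  using assms by auto

lemma circle_bij_frame: "distinct [a, b, c] \<Longrightarrow> circle_bij (frame a b c)"
  unfolding frame_def by (intro circle_bij_linfrac frame_det)

lemma frame_denominator:
  fixes a b c w :: complex
  assumes "distinct [a, b, c]"
  shows "c * (b - a) * w + b * (c - a) \<noteq> 0 \<or> (b - a) * w + (c - a) \<noteq> 0"
  using det_nonzero_imp[OF frame_det[OF assms], of w 1] by simp

lemma frame_None: "distinct [a, b, c] \<Longrightarrow> frame a b c None = Some c"
  by (auto simp add: frame_def linfrac_def proj_def)

lemma frame_zero: "distinct [a, b, c] \<Longrightarrow> frame a b c (Some 0) = Some b"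
  by (auto simp add: frame_Some proj_def)

lemma frame_minus_one:
  assumes "distinct [a, b, c]"
  shows "frame a b c (Some (- 1)) = Some a"
proof -
  have "frame a b c (Some (- 1)) = proj ((c - b) * a) ((c - b) * 1)"
    by (simp add: frame_Some algebra_simps)
  also have "\<dots> = Some a"
    using assms by (subst proj_scale) (auto simp: proj_def)
  finally show ?thesis .
qed

lemma frame_fourth_point:
  assumes "distinct [a, b, c, d]"
  shows "frame a b c (Some (- cross_ratio c a b d)) = Some d"
proof -
  define k where "k = (a - b) * (d - c)"
  have k: "k \<noteq> 0" and l: "cross_ratio c a b d * k = (c - a) * (b - d)"
    using assms by (auto simp: k_def cross_ratio_def)
  have "(c * (b - a) * (- cross_ratio c a b d) + b * (c - a)) * k
      = d * (((b - a) * (- cross_ratio c a b d) + (c - a)) * k)"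
    using l unfolding k_def by algebra
  then have "c * (b - a) * (- cross_ratio c a b d) + b * (c - a)
      = d * ((b - a) * (- cross_ratio c a b d) + (c - a))"
    using k by (simp flip: mult.assoc)
  then show ?thesis
    using frame_denominator[of a b c "- cross_ratio c a b d"] assms
    unfolding frame_Some by (auto simp: proj_def)
qed

text \<open>Exchanging \<open>a\<close> with \<open>c\<close> and \<open>b\<close> with \<open>d\<close> only changes the sign of the root. Consequently
  opposite edge points form a pair that does not depend on a choice of branch.\<close>
lemma frame_opposite:
  assumes "distinct [a, b, c, d]" and s: "s\<^sup>2 = cross_ratio c a b d"
  shows "frame c d a (Some s) = frame a b c (Some (- s))"
  unfolding frame_Some
proof (rule proj_eqI)
  have "s\<^sup>2 * ((a - b) * (d - c)) = (c - a) * (b - d)"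
    using assms by (auto simp: cross_ratio_def)
  then show "(a * (d - c) * s + d * (a - c)) * ((b - a) * - s + (c - a)) =
      (c * (b - a) * - s + b * (c - a)) * ((d - c) * s + (a - c))"
    by algebra
  have "distinct [c, d, a]" "distinct [a, b, c]" using assms(1) by auto
  then show "a * (d - c) * s + d * (a - c) \<noteq> 0 \<or> (d - c) * s + (a - c) \<noteq> 0"
    "c * (b - a) * - s + b * (c - a) \<noteq> 0 \<or> (b - a) * - s + (c - a) \<noteq> 0"
    by (simp_all only: frame_denominator)
qed

text \<open>This expresses the second pair of edge points in the coordinate of the first, so that all
  four can be compared in one coordinate. The case \<open>m\<^sup>2 = 1\<close> would mean \<open>a = b\<close> or \<open>c = d\<close>.\<close>
lemma frame_shift:
  assumes "distinct [a, b, c, d]" and m: "m\<^sup>2 = cross_ratio d b c a"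
  shows "m\<^sup>2 \<noteq> 1" and "frame b c d (Some m) = frame a b c (Some (m / (1 - m)))"
proof -
  have *: "m\<^sup>2 * ((b - c) * (a - d)) = (d - b) * (c - a)"
    using assms by (simp add: cross_ratio_def)
  show m1: "m\<^sup>2 \<noteq> 1"
  proof
    assume "m\<^sup>2 = 1"
    with * have "(b - c) * (a - d) - (d - b) * (c - a) = 0" by simp
    also have "(b - c) * (a - d) - (d - b) * (c - a) = (a - b) * (d - c)"
      by (simp add: algebra_simps)
    finally have "(a - b) * (d - c) = 0" .
    with assms(1) show False by auto
  qed
  then have n: "1 - m \<noteq> 0" by auto
  define x where "x = c * (b - a) * m + b * (c - a) * (1 - m)"
  define y where "y = (b - a) * m + (c - a) * (1 - m)"
  have "(1 - m) * (c * (b - a) * (m / (1 - m)) + b * (c - a)) = x"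
    "(1 - m) * ((b - a) * (m / (1 - m)) + (c - a)) = y"
    using n unfolding x_def y_def distrib_left by (simp_all add: ac_simps)
  then have "frame a b c (Some (m / (1 - m))) = proj x y"
    unfolding frame_Some using proj_scale[OF n] by metis
  moreover have "proj (d * (c - b) * m + c * (d - b)) ((c - b) * m + (d - b)) = proj x y"
  proof (rule proj_eqI)
    have "(d * (c - b) * m + c * (d - b)) * y - x * ((c - b) * m + (d - b)) =
       (b - c) * (m\<^sup>2 * ((b - c) * (a - d)) - (d - b) * (c - a))"
      unfolding x_def y_def by (simp add: algebra_simps power2_eq_square)
    then show "(d * (c - b) * m + c * (d - b)) * y = x * ((c - b) * m + (d - b))"
      unfolding * by simp
    have "distinct [b, c, d]" using assms(1) by simp
    then show "d * (c - b) * m + c * (d - b) \<noteq> 0 \<or> (c - b) * m + (d - b) \<noteq> 0"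
      by (rule frame_denominator)
    show "x \<noteq> 0 \<or> y \<noteq> 0"
      unfolding x_def y_def using assms(1) n by (intro det_nonzero_imp frame_det) auto
  qed
  ultimately show "frame b c d (Some m) = frame a b c (Some (m / (1 - m)))"
    by (simp add: frame_Some)
qed

text \<open>The set of the four edge points, described with all square roots instead of principal ones.
  This form is needed because conjugation maps the principal square root of a negative number to the
  other root.\<close>
definition quad_points :: "complex \<Rightarrow> complex \<Rightarrow> complex \<Rightarrow> complex \<Rightarrow> complex option set" where
  "quad_points a b c d =
     {frame a b c (Some s) | s. s\<^sup>2 = cross_ratio c a b d} \<union>
     {frame b c d (Some m) | m. m\<^sup>2 = cross_ratio d b c a}"

lemma edge_point_opposite:
  assumes "distinct [a, b, c, d]"
  shows "edge_point c d a b = frame a b c (Some (- csqrt (cross_ratio c a b d)))"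
  unfolding edge_point_eq_frame cross_ratio_opposite[of c a b d, symmetric]
  by (rule frame_opposite[OF assms]) simp

lemma roots_conv_csqrt: "{f s | s. s\<^sup>2 = z} = {f (csqrt z), f (- csqrt z)}"
proof -
  have "s\<^sup>2 = z \<longleftrightarrow> s = csqrt z \<or> s = - csqrt z" for s
    by (metis power2_csqrt power2_eq_iff)
  then show ?thesis by auto
qed

lemma edge_points_eq_quad_points:
  assumes "distinct [a, b, c, d]"
  shows "{edge_point d a b c, edge_point a b c d, edge_point b c d a, edge_point c d a b}
    = quad_points a b c d"
proof -
  have "distinct [b, c, d, a]" using assms by auto
  then show ?thesis
    using edge_point_opposite[OF assms] edge_point_opposite[of b c d a]
    unfolding quad_points_def roots_conv_csqrt edge_point_eq_frame by auto
qed

text \<open>The hypothesis says that the pairs \<open>s, - s\<close> and \<open>v, w\<close> are harmonic. So some fractional linear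
  map sends \<open>\<infinity>, 0, 1, - 1\<close> to these four points, and the circle is the image of the real
  line.\<close>
lemma harmonic_points_on_circle:
  assumes "s \<noteq> 0" "v * w = s\<^sup>2" "v \<noteq> w"
  shows "\<exists>!k. gen_circle k \<and> {Some s, Some (- s), Some v, Some w} \<subseteq> k"
proof -
  have "(s - v) * (s + v) = v * (w - v)"
    using assms(2) by algebra
  with assms have "(s - v) * (s + v) \<noteq> 0" by auto
  then have vs: "s - v \<noteq> 0" "s + v \<noteq> 0" by auto
  \<comment> \<open>The columns are multiples of \<open>(s, 1)\<close> and \<open>(- s, 1)\<close>, the images of \<open>\<infinity>\<close> and \<open>0\<close>;
    up to a common factor, \<open>s + v\<close> and \<open>s - v\<close> are determined by \<open>1 \<mapsto> v\<close>.\<close>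
  define N where "N = linfrac (s * (s + v)) (- s * (s - v)) (s + v) (s - v)"
  have "s * (s + v) * (s - v) - (- s * (s - v)) * (s + v) = 2 * s * (s - v) * (s + v)"
    by (simp add: algebra_simps)
  with assms(1) vs have N: "circle_bij N"
    unfolding N_def by (intro circle_bij_linfrac) auto
  have "N None = Some s" "N (Some 0) = Some (- s)"
    using vs by (simp_all add: N_def linfrac_def proj_def)
  moreover have "N (Some 1) = Some v" "N (Some (- 1)) = Some w"
  proof -
    have "v \<noteq> 0" using assms(1,2) by auto
    have "N (Some 1) = proj (2 * s * v) (2 * s * 1)"
      by (simp add: N_def linfrac_def algebra_simps)
    also have "\<dots> = proj v 1" using assms(1) by (intro proj_scale) simp
    finally show "N (Some 1) = Some v" by (simp add: proj_def)
    have "N (Some (- 1)) = proj (- 2 * s\<^sup>2) (- 2 * v)"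
      by (simp add: N_def linfrac_def algebra_simps power2_eq_square)
    also have "\<dots> = proj (- 2 * v * w) (- 2 * v * 1)"
      by (simp flip: assms(2) add: mult.assoc)
    also have "\<dots> = proj w 1" using \<open>v \<noteq> 0\<close> by (intro proj_scale) simp
    finally show "N (Some (- 1)) = Some w" by (simp add: proj_def)
  qed
  ultimately have im: "N ` {None, Some 0, Some 1, Some (- 1)} = {Some s, Some (- s), Some v, Some w}"
    by simp
  have "\<exists>!k. gen_circle k \<and> {None, Some 0, Some 1, Some (- 1)} \<subseteq> k"
  proof (rule ex1I[of _ real_line])
    show "gen_circle real_line \<and> {None, Some 0, Some 1, Some (- 1)} \<subseteq> real_line"
      using gen_circle_real_line by (simp add: real_line_def)
    show "k = real_line" if "gen_circle k \<and> {None, Some 0, Some 1, Some (- 1)} \<subseteq> k" for k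
      using that real_line_unique[of k 1] by simp
  qed
  from ex1_circle_image[OF N this] show ?thesis unfolding im .
qed

lemma cross_ratio_shift:
  assumes "distinct [a, b, c, d]"
  shows "1 / cross_ratio c a b d + 1 / cross_ratio d b c a = 1"
proof -
  have "(d - b) * (c - a) = - ((c - a) * (b - d))" "(b - c) * (a - d) = - ((b - c) * (d - a))"
    by (simp_all add: algebra_simps)
  then have "1 / cross_ratio c a b d + 1 / cross_ratio d b c a =
      ((a - b) * (d - c) + (b - c) * (d - a)) / ((c - a) * (b - d))"
    by (simp add: cross_ratio_def add_divide_distrib)
  also have "(a - b) * (d - c) + (b - c) * (d - a) = (c - a) * (b - d)"
    by (simp add: algebra_simps)
  finally show ?thesis
    using assms by auto
qed

lemma cross_ratio_nonzero: "distinct [a, b, c, d] \<Longrightarrow> cross_ratio a b c d \<noteq> 0"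
  by (auto simp add: cross_ratio_def)

text \<open>In the coordinate \<open>frame a b c\<close> the edge points are \<open>s\<close>, \<open>- s\<close>, \<open>m / (1 - m)\<close> and
  \<open>- m / (1 + m)\<close>, where \<open>s\<^sup>2\<close> and \<open>m\<^sup>2\<close> are the two cross-ratios. The relation
  \<open>1 / s\<^sup>2 + 1 / m\<^sup>2 = 1\<close> makes the product of the last two equal to \<open>s\<^sup>2\<close>, so the two pairs are
  harmonic.\<close>
lemma quad_circle_exists_unique:
  assumes "distinct [a, b, c, d]"
  shows "\<exists>!k. gen_circle k \<and> quad_points a b c d \<subseteq> k"
proof -
  define s where "s = csqrt (cross_ratio c a b d)"
  define m where "m = csqrt (cross_ratio d b c a)"
  have s2: "s\<^sup>2 = cross_ratio c a b d" and m2: "m\<^sup>2 = cross_ratio d b c a" "(- m)\<^sup>2 = cross_ratio d b c a"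
    by (simp_all add: s_def m_def)
  have "distinct [c, a, b, d]" "distinct [d, b, c, a]" using assms by auto
  then have s0: "s \<noteq> 0" and m0: "m \<noteq> 0"
    using cross_ratio_nonzero s2 m2(1) by fastforce+
  have m1: "1 - m \<noteq> 0" "1 + m \<noteq> 0"
    using frame_shift(1)[OF assms m2(1)] by (auto simp: add_eq_0_iff power2_eq_1_iff)
  have "1 / s\<^sup>2 + 1 / m\<^sup>2 = 1"
    using cross_ratio_shift[OF assms] s2 m2 by simp
  then have "s\<^sup>2 + m\<^sup>2 = s\<^sup>2 * m\<^sup>2"
    using s0 m0 by (simp add: field_simps)
  then have prod: "m / (1 - m) * (- m / (1 + m)) = s\<^sup>2"
    using m1 by (simp add: divide_simps) algebra
  have neq: "m / (1 - m) \<noteq> - m / (1 + m)"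
    using m1 m0 by (simp add: divide_simps) algebra
  have "quad_points a b c d =
      frame a b c ` {Some s, Some (- s), Some (m / (1 - m)), Some (- m / (1 + m))}"
    using frame_shift(2)[OF assms m2(1)] frame_shift(2)[OF assms m2(2)]
    unfolding quad_points_def roots_conv_csqrt by (auto simp: s_def m_def)
  moreover have "circle_bij (frame a b c)" using assms by (intro circle_bij_frame) auto
  from ex1_circle_image[OF this harmonic_points_on_circle[OF s0 prod neq]]
  have "\<exists>!k. gen_circle k \<and>
      frame a b c ` {Some s, Some (- s), Some (m / (1 - m)), Some (- m / (1 + m))} \<subseteq> k" .
  ultimately show ?thesis by (simp only:)
qed

section \<open>Moebius invariance\<close>

lemma linfrac_Some:
  assumes "linfrac p q r s (Some x) = Some x'"
  shows "r * x + s \<noteq> 0" "p * x + q = x' * (r * x + s)"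
  using assms by (auto simp: linfrac_def proj_def split: if_splits)

text \<open>Differences are multiplied by one factor for each of the two points; these factors cancel in
  every expression, such as a cross-ratio, in which each point occurs equally often above and below
  the line.\<close>
lemma linfrac_difference:
  assumes "linfrac p q r s (Some x) = Some x'" "linfrac p q r s (Some y) = Some y'"
  shows "(p * s - q * r) * (x - y) = (x' - y') * ((r * x + s) * (r * y + s))"
  using linfrac_Some(2)[OF assms(1)] linfrac_Some(2)[OF assms(2)] by algebra

lemma cross_ratio_linfrac:
  assumes det: "p * s \<noteq> q * r"
    and "linfrac p q r s (Some a) = Some a'" "linfrac p q r s (Some b) = Some b'"
    "linfrac p q r s (Some c) = Some c'" "linfrac p q r s (Some d) = Some d'"
  shows "cross_ratio a' b' c' d' = cross_ratio a b c d"
proof -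
  define \<Delta> where "\<Delta> = p * s - q * r"
  define k where "k = (r * a + s) * (r * b + s) * (r * c + s) * (r * d + s)"
  have \<Delta>: "\<Delta> \<noteq> 0" using det by (simp add: \<Delta>_def)
  have k: "k \<noteq> 0" using assms(2-)[THEN linfrac_Some(1)] by (simp add: k_def)
  note diff = linfrac_difference[of p q r s, folded \<Delta>_def]
  have "cross_ratio a b c d =
      ((\<Delta> * (a - b)) * (\<Delta> * (c - d))) / ((\<Delta> * (b - c)) * (\<Delta> * (d - a)))"
    using \<Delta> by (simp add: cross_ratio_def)
  also have "\<dots> = (k * ((a' - b') * (c' - d'))) / (k * ((b' - c') * (d' - a')))"
    unfolding diff[OF assms(2,3)] diff[OF assms(4,5)] diff[OF assms(3,4)] diff[OF assms(5,2)] k_def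
    by (simp only: ac_simps)
  also have "\<dots> = cross_ratio a' b' c' d'"
    using k by (simp add: cross_ratio_def)
  finally show ?thesis by simp
qed

text \<open>A projective coordinate is determined by its three base points, so it is carried along by any
  fractional linear map.\<close>
lemma linfrac_frame:
  assumes det: "p * s \<noteq> q * r" and "distinct [a, b, c]"
    and a: "linfrac p q r s (Some a) = Some a'" and b: "linfrac p q r s (Some b) = Some b'"
    and c: "linfrac p q r s (Some c) = Some c'"
  shows "linfrac p q r s (frame a b c (Some w)) = frame a' b' c' (Some w)"
proof -
  define \<Delta> where "\<Delta> = p * s - q * r"
  define k where "k = (r * a + s) * (r * b + s) * (r * c + s)"
  have \<Delta>: "\<Delta> \<noteq> 0" using det by (simp add: \<Delta>_def)
  have k: "k \<noteq> 0" using a b c by (auto simp: k_def dest: linfrac_Some)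
  have ba: "\<Delta> * (b - a) = (b' - a') * ((r * b + s) * (r * a + s))"
    and ca: "\<Delta> * (c - a) = (c' - a') * ((r * c + s) * (r * a + s))"
    unfolding \<Delta>_def by (intro linfrac_difference a b c)+
  define x where "x = c * (b - a) * w + b * (c - a)"
  define y where "y = (b - a) * w + (c - a)"
  define x' where "x' = c' * (b' - a') * w + b' * (c' - a')"
  define y' where "y' = (b' - a') * w + (c' - a')"
  have "\<Delta> * (p * x + q * y) =
      (p * c + q) * (\<Delta> * (b - a)) * w + (p * b + q) * (\<Delta> * (c - a))"
    "\<Delta> * (r * x + s * y) =
      (r * c + s) * (\<Delta> * (b - a)) * w + (r * b + s) * (\<Delta> * (c - a))"
    unfolding x_def y_def by (simp_all add: algebra_simps)
  then have "\<Delta> * (p * x + q * y) = k * x'" "\<Delta> * (r * x + s * y) = k * y'"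
    unfolding ba ca linfrac_Some(2)[OF b] linfrac_Some(2)[OF c] k_def x'_def y'_def
    by (simp_all add: algebra_simps)
  then have "proj (p * x + q * y) (r * x + s * y) = proj x' y'"
    using proj_scale[OF \<Delta>, of "p * x + q * y" "r * x + s * y"] proj_scale[OF k, of x' y'] by simp
  then show ?thesis
    using linfrac_proj[of x y p q r s] frame_denominator[OF assms(2), of w]
    unfolding frame_Some x_def y_def x'_def y'_def by simp
qed

lemma quad_points_linfrac:
  assumes det: "p * s \<noteq> q * r" and dist: "distinct [a, b, c, d]"
    and a: "linfrac p q r s (Some a) = Some a'" and b: "linfrac p q r s (Some b) = Some b'"
    and c: "linfrac p q r s (Some c) = Some c'" and d: "linfrac p q r s (Some d) = Some d'"
  shows "linfrac p q r s ` quad_points a b c d = quad_points a' b' c' d'"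
proof -
  have "linfrac p q r s (frame a b c (Some w)) = frame a' b' c' (Some w)"
    "linfrac p q r s (frame b c d (Some w)) = frame b' c' d' (Some w)" for w
    using dist by (auto intro!: linfrac_frame det a b c d)
  moreover have "cross_ratio c' a' b' d' = cross_ratio c a b d"
    "cross_ratio d' b' c' a' = cross_ratio d b c a"
    by (intro cross_ratio_linfrac[OF det] a b c d)+
  ultimately show ?thesis
    unfolding quad_points_def roots_conv_csqrt by (simp add: image_Un)
qed

lemma map_cnj_frame: "map_option cnj (frame a b c (Some w)) = frame (cnj a) (cnj b) (cnj c) (Some (cnj w))"
  by (simp add: frame_def map_cnj_linfrac)

lemma quad_points_cnj:
  "map_option cnj ` quad_points a b c d = quad_points (cnj a) (cnj b) (cnj c) (cnj d)"
proof -
  have cr: "cross_ratio (cnj x) (cnj y) (cnj z) (cnj t) = cnj (cross_ratio x y z t)" for x y z t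
    by (simp add: cross_ratio_def)
  have sq: "map_option cnj ` {frame x y z (Some s) | s. s\<^sup>2 = l} =
    {frame (cnj x) (cnj y) (cnj z) (Some s) | s. s\<^sup>2 = cnj l}" (is "?L = ?R") for x y z l
  proof
    show "?L \<subseteq> ?R" by (auto simp: map_cnj_frame simp flip: complex_cnj_power)
    show "?R \<subseteq> ?L"
    proof
      fix v assume "v \<in> ?R"
      then obtain s where s: "s\<^sup>2 = cnj l" "v = frame (cnj x) (cnj y) (cnj z) (Some s)" by blast
      then have "(cnj s)\<^sup>2 = l" "v = map_option cnj (frame x y z (Some (cnj s)))"
        by (simp_all add: map_cnj_frame flip: complex_cnj_power)
      then show "v \<in> ?L" by blast
    qed
  qed
  show ?thesis
    unfolding quad_points_def image_Un sq cr ..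
qed

text \<open>A fractional linear map preserves both the cross-ratios and the coordinates. Conjugation replaces
  the cross-ratios and the coordinates by their conjugates, and the conjugates of the square roots of
  \<open>z\<close> are the square roots of \<open>cnj z\<close>.\<close>
lemma quad_points_moebius:
  assumes M: "moebius M" and dist: "distinct [a, b, c, d]"
    and "M (Some a) = Some a'" "M (Some b) = Some b'" "M (Some c) = Some c'" "M (Some d) = Some d'"
  shows "M ` quad_points a b c d = quad_points a' b' c' d'"
proof -
  obtain p q r s where det: "p * s \<noteq> q * r"
    and cases: "M = linfrac p q r s \<or> M = linfrac p q r s \<circ> map_option cnj"
    using moebius_cases[OF M] by blast
  from cases show ?thesis
  proof
    assume "M = linfrac p q r s"
    then show ?thesis using quad_points_linfrac[OF det dist] assms(3-) by simp
  next
    assume M: "M = linfrac p q r s \<circ> map_option cnj"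
    have "linfrac p q r s ` quad_points (cnj a) (cnj b) (cnj c) (cnj d) = quad_points a' b' c' d'"
      using assms(3-) dist by (intro quad_points_linfrac[OF det]) (auto simp: M)
    then show ?thesis unfolding M image_comp[symmetric] quad_points_cnj .
  qed
qed

lemma circle_bij_moebius: "moebius M \<Longrightarrow> circle_bij M"
  by (erule moebius_cases) (metis circle_bij_linfrac circle_bij_compose circle_bij_cnj)

lemma quad_circle_moebius:
  assumes M: "moebius M" and dist: "distinct [a, b, c, d]"
    and img: "M (Some a) = Some a'" "M (Some b) = Some b'" "M (Some c) = Some c'" "M (Some d) = Some d'"
  shows "M ` quad_circle a b c d = quad_circle a' b' c' d'"
proof -
  have bij: "circle_bij M" by (rule circle_bij_moebius[OF M])
  then have "inj M" by (simp add: circle_bij_def bij_is_inj)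
  then have eq: "M (Some x) = M (Some y) \<longleftrightarrow> x = y" for x y by (simp add: inj_eq)
  have dist': "distinct [a', b', c', d']"
    using eq[of a b] eq[of a c] eq[of a d] eq[of b c] eq[of b d] eq[of c d] dist unfolding img by simp
  have quad: "quad_circle x y z t = (THE K. gen_circle K \<and> quad_points x y z t \<subseteq> K)"
    if "distinct [x, y, z, t]" for x y z t
    unfolding quad_circle_def edge_points_eq_quad_points[OF that] ..
  have "gen_circle (quad_circle a b c d) \<and> quad_points a b c d \<subseteq> quad_circle a b c d"
    unfolding quad[OF dist] by (rule theI'[OF quad_circle_exists_unique[OF dist]])
  then have "gen_circle (M ` quad_circle a b c d) \<and> quad_points a' b' c' d' \<subseteq> M ` quad_circle a b c d"
    using bij image_mono[of _ _ M] unfolding quad_points_moebius[OF M dist img, symmetric]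
    by (simp add: circle_bij_def)
  then show ?thesis
    unfolding quad[OF dist'] using the1_equality[OF quad_circle_exists_unique[OF dist']] by metis
qed

section \<open>Concyclic quadrilaterals\<close>

text \<open>In the coordinate \<open>frame a b c\<close> the circle through \<open>a\<close>, \<open>b\<close>, \<open>c\<close> is the real line, being the
  circle through \<open>\<infinity>\<close>, \<open>0\<close>, \<open>- 1\<close>.\<close>
lemma circle_eq_frame_image:
  assumes dist: "distinct [a, b, c]" and K: "gen_circle K" "{Some a, Some b, Some c} \<subseteq> K"
  shows "K = frame a b c ` real_line"
proof -
  have bij: "circle_bij (frame a b c)" by (rule circle_bij_frame[OF dist])
  then have im: "frame a b c ` (frame a b c -` K) = K"
    by (simp add: circle_bij_def bij_is_surj)
  have "frame a b c -` K = real_line"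
  proof (rule real_line_unique)
    show "gen_circle (frame a b c -` K)" using bij K(1) im by (metis circle_bij_def)
    show "None \<in> frame a b c -` K" "Some 0 \<in> frame a b c -` K" "Some (of_real (- 1)) \<in> frame a b c -` K"
      using K(2) frame_None[OF dist] frame_zero[OF dist] frame_minus_one[OF dist] by simp_all
  qed simp
  with im show ?thesis by simp
qed

text \<open>The coordinate of \<open>d\<close> is minus the cross-ratio, and the points of the circle have real
  coordinates.\<close>
lemma cross_ratio_real_if_concyclic:
  assumes dist: "distinct [a, b, c, d]" and K: "gen_circle K" "{Some a, Some b, Some c, Some d} \<subseteq> K"
  shows "cross_ratio c a b d \<in> \<real>"
proof -
  have "Some d \<in> frame a b c ` real_line"
    using circle_eq_frame_image[of a b c K] assms by auto
  then obtain z where z: "z \<in> real_line" "frame a b c z = Some d" by (metis imageE)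
  have "inj (frame a b c)"
    using circle_bij_frame[of a b c] dist by (simp add: circle_bij_def bij_is_inj)
  with z(2) frame_fourth_point[OF dist] have "z = Some (- cross_ratio c a b d)"
    by (metis injD)
  with z(1) have "- cross_ratio c a b d \<in> \<real>" by (auto simp: real_line_def)
  then show ?thesis by simp
qed

lemma edge_points_on_circle:
  assumes dist: "distinct [a, b, c, d]" and K: "gen_circle K" "{Some a, Some b, Some c, Some d} \<subseteq> K"
    and pos: "positive_real (cross_ratio c a b d)"
  shows "{edge_point a b c d, edge_point c d a b} \<subseteq> K"
proof -
  obtain x where "cross_ratio c a b d = of_real x" "x > 0"
    using pos by (auto simp: positive_real_def elim: Reals_cases)
  then have "csqrt (cross_ratio c a b d) \<in> \<real>" by simp
  then have "Some (csqrt (cross_ratio c a b d)) \<in> real_line" "Some (- csqrt (cross_ratio c a b d)) \<in> real_line"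
    by (auto simp: real_line_def)
  then show ?thesis
    using circle_eq_frame_image[of a b c K] dist K
    unfolding edge_point_opposite[OF dist] unfolding edge_point_eq_frame by auto
qed

lemma cross_ratio_as_quotient:
  assumes "distinct [a, b, c, d]"
  shows "(c - a) / (c - d) = cross_ratio c a b d * ((b - a) / (b - d))"
proof -
  have swap: "(a - b) * (d - c) = (b - a) * (c - d)" by (simp add: algebra_simps)
  have "b - a \<noteq> 0" "b - d \<noteq> 0" using assms by auto
  then show ?thesis unfolding cross_ratio_def swap by simp
qed

text \<open>The cross-ratio is the quotient of \<open>(c - a) / (c - d)\<close> by \<open>(b - a) / (b - d)\<close>. If both are real
  and the quotient is negative, one of them is negative, and then \<open>c\<close> or \<open>b\<close> lies between \<open>a\<close> and
  \<open>d\<close>.\<close>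
lemma edges_cross_if_collinear:
  fixes a b c d :: complex
  assumes "distinct [a, b, c, d]" and l: "cross_ratio c a b d = of_real l" "l < 0"
    and x: "(b - a) / (b - d) = of_real x"
  shows "closed_segment b c \<inter> closed_segment d a \<noteq> {}"
proof -
  have between: "z \<in> closed_segment d a" if "(z - a) / (z - d) = of_real t" "t < 0" "z \<noteq> d" for z and t :: real
  proof -
    define v where "v = 1 / (1 - t)"
    have v: "0 \<le> v" "v \<le> 1" "v * (1 - t) = 1" using that(2) by (simp_all add: v_def)
    have "z - d \<noteq> 0" using that(3) by simp
    with that(1) have "z - a = of_real t * (z - d)" by (metis nonzero_divide_eq_eq)
    then have "a - d = of_real (1 - t) * (z - d)"
      unfolding of_real_diff of_real_1 by algebra
    then have "of_real v * (a - d) = of_real (v * (1 - t)) * (z - d)"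
      by (simp only: of_real_mult mult.assoc)
    then have "z - d = of_real v * (a - d)" unfolding v(3) by simp
    then have "z = (1 - of_real v) * d + of_real v * a" by algebra
    then have "z = (1 - v) *\<^sub>R d + v *\<^sub>R a" by (simp add: scaleR_conv_of_real)
    with v show ?thesis unfolding in_segment by blast
  qed
  have nz: "b \<noteq> d" "c \<noteq> d" "b \<noteq> a" using assms(1) by auto
  have "(c - a) / (c - d) = cross_ratio c a b d * ((b - a) / (b - d))"
    using assms(1) by (rule cross_ratio_as_quotient)
  then have y: "(c - a) / (c - d) = of_real (l * x)" unfolding l(1) x by simp
  have "x \<noteq> 0" using x nz by auto
  then have "x < 0 \<or> l * x < 0" using l(2) by (auto simp: mult_less_0_iff)
  then have "b \<in> closed_segment d a \<or> c \<in> closed_segment d a"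
    using between[OF x] between[OF y] nz by blast
  then show ?thesis by auto
qed

text \<open>Applied with the centre of a circle as origin and \<open>x\<close>, \<open>y\<close> on the circle, this gives the
  power of the point dividing a chord: the product of the two parts of the chord.\<close>
lemma cmod_convex_combination:
  "(cmod ((1 - v) *\<^sub>R x + v *\<^sub>R y))\<^sup>2 =
    (1 - v) * (cmod x)\<^sup>2 + v * (cmod y)\<^sup>2 - v * (1 - v) * (cmod (x - y))\<^sup>2"
proof -
  have "((1 - v) * s + v * t)\<^sup>2 = (1 - v) * s\<^sup>2 + v * t\<^sup>2 - v * (1 - v) * (s - t)\<^sup>2" for s t :: real
    by algebra
  from this[of "Re x" "Re y"] this[of "Im x" "Im y"] show ?thesis
    unfolding cmod_power2 by (simp add: distrib_left)
qed

text \<open>Now \<open>(b - a) / (b - d)\<close> and \<open>(c - a) / (c - d)\<close> have imaginary parts of opposite sign, so \<open>b\<close>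
  and \<open>c\<close> lie on different sides of the line through \<open>a\<close> and \<open>d\<close>. The segment \<open>bc\<close> meets this line
  in a point of the disc, and the part of the line in the disc is the segment \<open>ad\<close>.\<close>
lemma edges_cross_if_on_sphere:
  fixes a b c d :: complex
  assumes dist: "distinct [a, b, c, d]" and l: "cross_ratio c a b d = of_real l" "l < 0"
    and sph: "{a, b, c, d} \<subseteq> sphere z r" and nonreal: "(b - a) / (b - d) \<notin> \<real>"
  shows "closed_segment b c \<inter> closed_segment d a \<noteq> {}"
proof -
  have nz: "b \<noteq> d" "c \<noteq> d" "b \<noteq> a" "a \<noteq> d" using dist by auto
  \<comment> \<open>The sign of \<open>h w\<close> tells the side of the line through \<open>a\<close> and \<open>d\<close> on which \<open>w\<close> lies.\<close>
  define h where "h w = Im ((w - a) * cnj (d - a))" for w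
  have side: "Im ((w - a) / (w - d)) = - h w / (cmod (w - d))\<^sup>2" for w
  proof -
    have "Im ((w - a) * cnj (w - d)) = - h w" by (simp add: h_def algebra_simps)
    then show ?thesis unfolding complex_div_cnj[of "w - a"] by (simp only: Im_divide_of_real)
  qed
  have "(c - a) / (c - d) = cross_ratio c a b d * ((b - a) / (b - d))"
    using dist by (rule cross_ratio_as_quotient)
  then have "Im ((c - a) / (c - d)) = l * Im ((b - a) / (b - d))"
    unfolding l(1) by (simp only: Im_complex_of_real Re_complex_of_real times_complex.sel)
  then have "h c / (cmod (c - d))\<^sup>2 = l * (h b / (cmod (b - d))\<^sup>2)"
    unfolding side by simp
  moreover have pos: "(cmod (c - d))\<^sup>2 > 0" "(cmod (b - d))\<^sup>2 > 0" using nz by simp_all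
  ultimately have hc: "h c = l * (h b / (cmod (b - d))\<^sup>2) * (cmod (c - d))\<^sup>2"
    by (metis less_irrefl nonzero_divide_eq_eq)
  define k where "k = - l * (cmod (c - d))\<^sup>2 / (cmod (b - d))\<^sup>2"
  have k: "k > 0" "h c = - k * h b"
    using l(2) pos by (simp_all add: k_def hc divide_neg_pos mult_neg_pos)
  \<comment> \<open>The affine function \<open>h\<close> vanishes at this parameter of the segment \<open>bc\<close>.\<close>
  define t where "t = 1 / (1 + k)"
  have t: "0 < t" "t < 1" and tk: "1 - t = k * t" using k by (simp_all add: t_def field_simps)
  define q where "q = (1 - t) *\<^sub>R b + t *\<^sub>R c"
  have qbc: "q \<in> closed_segment b c" unfolding in_segment q_def using t by (intro exI[of _ t]) auto
  have "h q = (1 - t) * h b + t * h c"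
    by (simp add: h_def q_def algebra_simps)
  then have "h q = 0" by (simp add: k(2) tk)
  then have "Im ((q - a) / (d - a)) = 0" unfolding h_def by (simp add: Im_complex_div_eq_0)
  then obtain u :: real where "(q - a) / (d - a) = of_real u"
    by (metis complex_is_Real_iff Reals_cases)
  then have qu: "q = (1 - u) *\<^sub>R a + u *\<^sub>R d"
    using nz by (simp add: scaleR_conv_of_real field_simps)
  \<comment> \<open>Comparing the power of \<open>q\<close> with respect to the circle along the two chords \<open>bc\<close> and \<open>ad\<close>
    shows that \<open>q\<close> lies between \<open>a\<close> and \<open>d\<close>.\<close>
  have chord: "(dist z ((1 - v) *\<^sub>R x + v *\<^sub>R y))\<^sup>2 = r\<^sup>2 - v * (1 - v) * (dist x y)\<^sup>2"
    if "x \<in> sphere z r" "y \<in> sphere z r" for x y :: complex and v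
  proof -
    have "z - ((1 - v) *\<^sub>R x + v *\<^sub>R y) = (1 - v) *\<^sub>R (z - x) + v *\<^sub>R (z - y)"
      by (simp add: algebra_simps)
    moreover have "cmod (z - x) = r" "cmod (z - y) = r" using that by (simp_all add: dist_norm)
    moreover have "cmod (x - y) = cmod ((z - x) - (z - y))" by (simp add: norm_minus_commute)
    ultimately show ?thesis
      unfolding dist_norm by (simp only: cmod_convex_combination) (simp add: algebra_simps)
  qed
  have "u * (1 - u) * (dist a d)\<^sup>2 = t * (1 - t) * (dist b c)\<^sup>2"
    using chord[of b c t] chord[of a d u] sph unfolding q_def[symmetric] qu[symmetric] by simp
  moreover have "t * (1 - t) * (dist b c)\<^sup>2 \<ge> 0" using t by simp
  moreover have "(dist a d)\<^sup>2 > 0" using nz by simp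
  ultimately have "u * (1 - u) \<ge> 0" by (metis zero_le_mult_iff not_less)
  then have "0 \<le> u" "u \<le> 1" by (auto simp: zero_le_mult_iff)
  then have "q \<in> closed_segment a d" unfolding in_segment qu by auto
  with qbc show ?thesis by (auto simp: closed_segment_commute)
qed

lemma edges_cross_if_cross_ratio_negative:
  assumes dist: "distinct [a, b, c, d]" and K: "gen_circle K" "{Some a, Some b, Some c, Some d} \<subseteq> K"
    and l: "cross_ratio c a b d = of_real l" "l < 0"
  shows "closed_segment b c \<inter> closed_segment d a \<noteq> {}"
proof (cases "(b - a) / (b - d) \<in> \<real>")
  case True
  then obtain x where "(b - a) / (b - d) = of_real x" by (rule Reals_cases)
  then show ?thesis by (rule edges_cross_if_collinear[OF dist l])
next
  case False
  have "\<exists>z r. K = Some ` sphere z r"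
  proof (rule ccontr)
    assume "\<not> ?thesis"
    then obtain u v where "K = insert None (Some ` (affine hull {u, v}))"
      using K(1) unfolding gen_circle_def by blast
    then have "{a, b, d} \<subseteq> affine hull {u, v}" using K(2) by auto
    then obtain s t x :: real
      where abd: "a = u + s * (v - u)" "b = u + t * (v - u)" "d = u + x * (v - u)"
      unfolding insert_subset in_line_iff by blast
    have "b - a = of_real (t - s) * (v - u)" "b - d = of_real (t - x) * (v - u)"
      unfolding abd by (simp_all add: algebra_simps)
    then have "(b - a) / (b - d) = (of_real (t - s) * (v - u)) / (of_real (t - x) * (v - u))"
      by simp
    also have "\<dots> \<in> \<real>"
      by (cases "v = u") (simp_all flip: of_real_diff of_real_divide)
    finally show False using False by blast
  qed
  then obtain z r where "K = Some ` sphere z r" by blast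
  then have "{a, b, c, d} \<subseteq> sphere z r" using K(2) by auto
  then show ?thesis using edges_cross_if_on_sphere[OF dist l _ False] by blast
qed

lemma noncrossing_imp_positive:
  assumes dist: "distinct [a, b, c, d]" and K: "gen_circle K" "{Some a, Some b, Some c, Some d} \<subseteq> K"
    and disj: "closed_segment b c \<inter> closed_segment d a = {}"
  shows "positive_real (cross_ratio c a b d)"
proof -
  obtain l where l: "cross_ratio c a b d = of_real l"
    using cross_ratio_real_if_concyclic[OF dist K] by (rule Reals_cases)
  have "\<not> l < 0" using edges_cross_if_cross_ratio_negative[OF dist K l] disj by blast
  moreover have "l \<noteq> 0" using cross_ratio_nonzero[of c a b d] dist l by auto
  ultimately show ?thesis by (simp add: positive_real_def l)
qed

theorem corollary3:
  fixes a b c d :: complex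
    and p_ab p_bc p_cd p_da :: "complex option"
  assumes "distinct [a, b, c, d]"
    and "p_ab = edge_point d a b c"
    and "p_bc = edge_point a b c d"
    and "p_cd = edge_point b c d a"
    and "p_da = edge_point c d a b"
  shows
    "(\<forall>K. gen_circle K \<and> {Some a, Some b, Some c, Some d} \<subseteq> K \<longrightarrow>
        (noncrossing_edges a b c d \<longrightarrow>
           positive_real (cross_ratio c a b d) \<and> positive_real (cross_ratio d b c a)) \<and>
        (positive_real (cross_ratio c a b d) \<longrightarrow> {p_bc, p_da} \<subseteq> K) \<and>
        (positive_real (cross_ratio c a b d) \<and> positive_real (cross_ratio d b c a) \<longrightarrow>
           {p_ab, p_bc, p_cd, p_da} \<subseteq> K)) \<and>
     (\<exists>!k. gen_circle k \<and> {p_ab, p_bc, p_cd, p_da} \<subseteq> k) \<and>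
     (\<forall>M a' b' c' d'. moebius M \<and>
        M (Some a) = Some a' \<and> M (Some b) = Some b' \<and>
        M (Some c) = Some c' \<and> M (Some d) = Some d' \<longrightarrow>
        M ` quad_circle a b c d = quad_circle a' b' c' d')"
proof -
  have dist: "distinct [a, b, c, d]" and dist': "distinct [b, c, d, a]"
    using assms(1) by auto
  have noncrossing: "positive_real (cross_ratio c a b d) \<and> positive_real (cross_ratio d b c a)"
    if K: "gen_circle K" "{Some a, Some b, Some c, Some d} \<subseteq> K" and nc: "noncrossing_edges a b c d" for K
  proof
    have disj: "closed_segment b c \<inter> closed_segment d a = {}" "closed_segment c d \<inter> closed_segment a b = {}"
      using nc unfolding noncrossing_edges_def by (simp_all only: Int_commute)
    show "positive_real (cross_ratio c a b d)"
      by (rule noncrossing_imp_positive[OF dist K disj(1)])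
    have "{Some b, Some c, Some d, Some a} \<subseteq> K" using K(2) by simp
    then show "positive_real (cross_ratio d b c a)"
      by (rule noncrossing_imp_positive[OF dist' K(1) _ disj(2)])
  qed
  have p_bc_da: "{p_bc, p_da} \<subseteq> K"
    if "gen_circle K" "{Some a, Some b, Some c, Some d} \<subseteq> K" "positive_real (cross_ratio c a b d)" for K
    unfolding assms(2-5) by (rule edge_points_on_circle[OF dist that])
  have p_cd_ab: "{p_cd, p_ab} \<subseteq> K"
    if K: "gen_circle K" "{Some a, Some b, Some c, Some d} \<subseteq> K" and pos: "positive_real (cross_ratio d b c a)" for K
  proof -
    have "{Some b, Some c, Some d, Some a} \<subseteq> K" using K(2) by simp
    then show ?thesis
      unfolding assms(2-5) by (rule edge_points_on_circle[OF dist' K(1) _ pos])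
  qed
  have all: "{p_ab, p_bc, p_cd, p_da} \<subseteq> K"
    if "gen_circle K" "{Some a, Some b, Some c, Some d} \<subseteq> K"
      "positive_real (cross_ratio c a b d)" "positive_real (cross_ratio d b c a)" for K
    using p_bc_da[OF that(1-3)] p_cd_ab[OF that(1,2,4)] by simp
  have unique: "\<exists>!k. gen_circle k \<and> {p_ab, p_bc, p_cd, p_da} \<subseteq> k"
    unfolding assms(2-5) edge_points_eq_quad_points[OF dist]
    by (rule quad_circle_exists_unique[OF dist])
  show ?thesis
  proof (rule conjI[OF _ conjI[OF unique]])
    show "\<forall>K. gen_circle K \<and> {Some a, Some b, Some c, Some d} \<subseteq> K \<longrightarrow>
        (noncrossing_edges a b c d \<longrightarrow>
           positive_real (cross_ratio c a b d) \<and> positive_real (cross_ratio d b c a)) \<and>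
        (positive_real (cross_ratio c a b d) \<longrightarrow> {p_bc, p_da} \<subseteq> K) \<and>
        (positive_real (cross_ratio c a b d) \<and> positive_real (cross_ratio d b c a) \<longrightarrow>
           {p_ab, p_bc, p_cd, p_da} \<subseteq> K)"
      using noncrossing p_bc_da all by meson
    show "\<forall>M a' b' c' d'. moebius M \<and>
        M (Some a) = Some a' \<and> M (Some b) = Some b' \<and>
        M (Some c) = Some c' \<and> M (Some d) = Some d' \<longrightarrow>
        M ` quad_circle a b c d = quad_circle a' b' c' d'"
      using quad_circle_moebius[OF _ dist] by blast
  qed
qed

end
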